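(* Let $k\in\mathbb{Z}^+$. Then $$1-(k-1)!\left(\sum_{n\geq 0}(n+k-1)!\,x^{n}\right)^{-1} \ =\ kx+\sum_{n\geq 1}a_n^{(k)}x^{n+1},$$ taken as formal power series.
   Context: All power series are considered as formal power series over the integers, a formal power series over a ring $R$ being an infinite series of monomials $c_0+c_1x+c_2x^2+\cdots$ with each $c_i\in R$. For $k\in\mathbb{Z}^+$, the sequence $a_n^{(k)}$ is defined by $a_0^{(k)}=1$ and, for $n\ge 1$, by the recurrence $$(k-1)!\,a_n^{(k)} = (n+k)!-k\,(n+k-1)!-\sum_{m=0}^{n-2}(n-m+k-2)!\,a_{m+1}^{(k)}$$ (an empty sum is $0$). *)

theory Defs
  imports "HOL-Computational_Algebra.Formal_Power_Series"
begin

(* For k >= 1. The range m < n - 1 is m = 0, ..., n - 2 for n >= 2 and is empty for n = 1. *)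
function aseq :: "nat \<Rightarrow> nat \<Rightarrow> rat" where
  "aseq k n =
    (if n = 0 then 1
     else (fact (n + k) - of_nat k * fact (n + k - 1)
             - (\<Sum>m<n - 1. fact (n - m + k - 2) * aseq k (m + 1))) / fact (k - 1))"
  by auto
termination
  by (relation "measure snd") auto

declare aseq.simps [simp del]

lemma aseq_0: "aseq k 0 = 1"
  by (simp add: aseq.simps)

lemma aseq_rec:
  assumes "n \<ge> 1"
  shows "fact (k - 1) * aseq k n =
    fact (n + k) - of_nat k * fact (n + k - 1)
      - (\<Sum>m<n - 1. fact (n - m + k - 2) * aseq k (m + 1))"
  using assms by (subst aseq.simps) simp

end

theory Submission
  imports Defs
begin

text \<open>
  Write \<open>F = (\<Sum>n\<ge>0. (n+k-1)! x^n)\<close> and let \<open>G\<close> be the right-hand side. The recurrence is the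
  comparison of the coefficients of \<open>x^(n+1)\<close> in \<open>F = (k-1)! + G F\<close>, which rearranges to
  the claim. Integrality follows by strong induction, because every factorial in the recurrence is
  a multiple of \<open>(k-1)!\<close>.
\<close>

lemma fact_divide_fact_Ints:
  assumes "n \<le> m"
  shows "(fact m / fact n :: 'a :: field_char_0) \<in> \<int>"
proof -
  obtain d :: nat where "fact m = fact n * d"
    using fact_dvd[OF assms] by (rule dvdE)
  then have "(fact m :: 'a) = fact n * of_nat d"
    by (metis of_nat_fact of_nat_mult)
  then show ?thesis by simp
qed

lemma aseq_Ints: "aseq k n \<in> \<int>"
proof (induction n rule: less_induct)
  case (less n)
  show ?case
  proof (cases "n = 0")
    case False
    have "aseq k n = fact (n + k) / fact (k - 1) - of_nat k * (fact (n + k - 1) / fact (k - 1))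
        - (\<Sum>m<n - 1. fact (n - m + k - 2) / fact (k - 1) * aseq k (m + 1))"
      using False by (subst aseq.simps) (simp add: diff_divide_distrib sum_divide_distrib)
    \<comment> \<open>The bound \<open>m < n - 1\<close> is used twice: it gives
      \<open>m + 1 < n\<close> for the induction hypothesis and
      \<open>k - 1 \<le> n - m + k - 2\<close> for the divisibility of the factorials.\<close>
    also have "\<dots> \<in> \<int>"
      using False less.IH
      by (intro Ints_diff Ints_mult Ints_sum Ints_of_nat fact_divide_fact_Ints) auto
    finally show ?thesis .
  qed (simp add: aseq_0)
qed

text \<open>Nesting the factors \<open>fps_X\<close> turns them into index shifts, so that
  \<open>A * F\<close> is the only genuine convolution left when coefficients are compared.\<close>

lemma fact_fps_eq:
  fixes k :: nat
  assumes "k \<ge> 1"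
  defines "F \<equiv> Abs_fps (\<lambda>n. fact (n + k - 1) :: rat)"
    and "A \<equiv> Abs_fps (\<lambda>n. aseq k (n + 1))"
  shows "F = fps_const (fact (k - 1)) + fps_X * (fps_const (of_nat k) * F + fps_X * (A * F))"
proof (rule fps_ext)
  fix N
  \<comment> \<open>The recurrence starts at index 1, which corresponds to \<open>N = 2\<close>.
    Below that, \<open>N = 1\<close> amounts to k! = k (k-1)!.\<close>
  consider "N = 0" | "N = 1" | n where "N = Suc (Suc n)"
    by (metis One_nat_def not0_implies_Suc)
  then show "fps_nth F N = fps_nth
    (fps_const (fact (k - 1)) + fps_X * (fps_const (of_nat k) * F + fps_X * (A * F))) N"
  proof cases
    case 2
    then show ?thesis
      using assms(1) by (simp add: F_def fact_reduce[of k])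
  next
    case (3 n)
    have "fps_nth (A * F) n = (\<Sum>m\<le>n. aseq k (m + 1) * fact (n - m + k - 1))"
      by (simp add: fps_mult_nth A_def F_def atLeast0AtMost)
    \<comment> \<open>The split-off term \<open>m = n\<close> is the left-hand side of the
      recurrence at index \<open>n + 1\<close>; the remaining sum is the one subtracted
      there.\<close>
    also have "\<dots> = (\<Sum>m<n. aseq k (m + 1) * fact (n - m + k - 1)) + aseq k (n + 1) * fact (k - 1)"
      by (simp add: lessThan_Suc_atMost[symmetric])
    also have "(\<Sum>m<n. aseq k (m + 1) * fact (n - m + k - 1)) =
        (\<Sum>m<n + 1 - 1. fact (n + 1 - m + k - 2) * aseq k (m + 1))"
      by (intro sum.cong) (auto simp: Suc_diff_le mult.commute)
    also have "\<dots> + aseq k (n + 1) * fact (k - 1) =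
        fact (n + 1 + k) - of_nat k * fact (n + 1 + k - 1)"
      using aseq_rec[of "n + 1" k] by (simp add: mult.commute)
    finally show ?thesis
      using 3 by (simp add: F_def)
  qed (simp add: F_def)
qed

theorem proposition2p2:
  fixes k :: nat
  assumes "k \<ge> 1"
  shows "(\<forall>n. aseq k n \<in> \<int>) \<and>
    1 - fps_const (fact (k - 1)) * inverse (Abs_fps (\<lambda>n. fact (n + k - 1) :: rat)) =
      fps_const (of_nat k) * fps_X + Abs_fps (\<lambda>j. if j \<ge> 2 then aseq k (j - 1) else 0)"
proof
  show "\<forall>n. aseq k n \<in> \<int>"
    by (simp add: aseq_Ints)
next
  define F where "F = Abs_fps (\<lambda>n. fact (n + k - 1) :: rat)"
  define A where "A = Abs_fps (\<lambda>n. aseq k (n + 1))"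
  define G where "G = fps_const (of_nat k) * fps_X + fps_X * (fps_X * A)"
  have G: "fps_const (of_nat k) * fps_X + Abs_fps (\<lambda>j. if j \<ge> 2 then aseq k (j - 1) else 0) = G"
    unfolding G_def by (rule fps_ext) (auto simp: A_def numeral_2_eq_2 Suc_diff_Suc)
  \<comment> \<open>The constant coefficient (k-1)! is nonzero in \<open>rat\<close>. For k > 2 it
    is not a unit in the integers, which is why the series have rational coefficients and
    integrality is shown separately.\<close>
  have inv: "F * inverse F = 1"
    by (rule inverse_mult_eq_1') (simp add: F_def)
  have "F = fps_const (fact (k - 1)) + G * F"
    using fact_fps_eq[OF assms] by (simp add: F_def A_def G_def algebra_simps)
  then have "fps_const (fact (k - 1)) = (1 - G) * F"
    by (simp add: algebra_simps)
  then have "fps_const (fact (k - 1)) * inverse F = 1 - G"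
    by (simp add: mult.assoc inv)
  then show "1 - fps_const (fact (k - 1)) * inverse (Abs_fps (\<lambda>n. fact (n + k - 1) :: rat)) =
      fps_const (of_nat k) * fps_X + Abs_fps (\<lambda>j. if j \<ge> 2 then aseq k (j - 1) else 0)"
    unfolding G F_def[symmetric] by simp
qed

end
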